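(* Let $\alpha$ be an isometric automorphism of $\ell_1=\ell_1(\mathbb{Z})$, and let $\sigma$ be the associated permutation of $\mathbb{Z}$. If $\sigma$ has an infinite orbit then $\mathrm{hc}(\alpha)=\infty$; if $\sigma$ has no infinite orbit then $\mathrm{hc}(\alpha)=0$.
   Context: $\ell_1$ is the complex Banach space of absolutely summable functions on $\mathbb{Z}$. For every isometric (surjective linear) automorphism $\alpha$ of $\ell_1$ there are a function $\lambda:\mathbb{Z}\to\mathbb{T}$ (the unit circle) and a permutation $\sigma$ of $\mathbb{Z}$ such that $\alpha(x)(s)=\lambda(s)x(\sigma(s))$ for all $x\in\ell_1$ and $s\in\mathbb{Z}$; $\sigma$ is the associated permutation. CA entropy: For a bounded linear map $\gamma:X\to Y$ of (complex) Banach spaces, a finite set $\Omega\subseteq X$ and $\delta>0$, let $\mathrm{CA}(\gamma,\Omega,\delta)$ be the collection of triples $(\phi,\psi,d)$ where $d$ is a positive integer and $\phi:X\to\ell_\infty^d$, $\psi:\ell_\infty^d\to Y$ are contractive (norm $\le1$) linear maps with $\|\psi\circ\phi(x)-\gamma(x)\|<\delta$ for all $x\in\Omega$. A CA embedding of $X$ is an isometric linear map $\iota$ from $X$ into a Banach space $Y$ such that $\mathrm{CA}(\iota,\Omega,\delta)\neq\emptyset$ for all finite $\Omega\subseteq X$ and $\delta>0$; every Banach space has one (e.g. the evaluation map $X\to C(B_1(X^* ))$, where $B_1(X^* )$ is the weak$^*$ compact unit ball of the dual). Set $\mathrm{rc}(\Omega,\delta)=\inf\{d:(\phi,\psi,d)\in\mathrm{CA}(\iota,\Omega,\delta)\}$,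 which does not depend on the CA embedding $\iota$. For an isometric (surjective linear) automorphism $\alpha$ of $X$ put $\mathrm{hc}(\alpha,\Omega,\delta)=\limsup_{n\to\infty}\frac1n\log\mathrm{rc}(\Omega\cup\alpha\Omega\cup\cdots\cup\alpha^{n-1}\Omega,\delta)$, $\mathrm{hc}(\alpha,\Omega)=\sup_{\delta>0}\mathrm{hc}(\alpha,\Omega,\delta)$, and $\mathrm{hc}(\alpha)=\sup_\Omega\mathrm{hc}(\alpha,\Omega)$ over finite $\Omega\subseteq X$. *)

theory Defs
  imports
    "HOL-Analysis.Analysis"
    "HOL-Probability.Discrete_Topology"
begin

section \<open>Complex Banach spaces\<close>

class complex_normed_vector = real_normed_vector +
  fixes scaleC :: "complex \<Rightarrow> 'a \<Rightarrow> 'a" (infixr "*\<^sub>C" 75)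
  assumes scaleC_add_right: "c *\<^sub>C (x + y) = c *\<^sub>C x + c *\<^sub>C y"
    and scaleC_add_left: "(c + d) *\<^sub>C x = c *\<^sub>C x + d *\<^sub>C x"
    and scaleC_scaleC: "c *\<^sub>C d *\<^sub>C x = (c * d) *\<^sub>C x"
    and scaleR_scaleC: "r *\<^sub>R x = complex_of_real r *\<^sub>C x"
    and norm_scaleC: "norm (c *\<^sub>C x) = cmod c * norm x"

class complex_banach = complex_normed_vector + complete_space

definition clinear :: "('a::complex_normed_vector \<Rightarrow> 'b::complex_normed_vector) \<Rightarrow> bool" where
  "clinear f \<longleftrightarrow> (\<forall>x y. f (x + y) = f x + f y) \<and> (\<forall>c x. f (c *\<^sub>C x) = c *\<^sub>C f x)"

definition isometric :: "('a::complex_normed_vector \<Rightarrow> 'b::complex_normed_vector) \<Rightarrow> bool" where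
  "isometric f \<longleftrightarrow> (\<forall>x. norm (f x) = norm x)"

definition isometric_automorphism :: "('a::complex_banach \<Rightarrow> 'a) \<Rightarrow> bool" where
  "isometric_automorphism \<alpha> \<longleftrightarrow> clinear \<alpha> \<and> isometric \<alpha> \<and> surj \<alpha>"


section \<open>CA entropy\<close>

text \<open>The dimension \<open>d\<close> of \<open>\<ell>\<^sub>\<infinity>\<^sup>d\<close> has to be a term, so the space is realised as the
  subspace of the functions \<open>nat \<Rightarrow> complex\<close> supported in \<open>{..<d}\<close>, with pointwise operations.\<close>

definition linf_space :: "nat \<Rightarrow> (nat \<Rightarrow> complex) set" where
  "linf_space d = {v. \<forall>i\<ge>d. v i = 0}"

definition linf_norm :: "nat \<Rightarrow> (nat \<Rightarrow> complex) \<Rightarrow> real" where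
  "linf_norm d v = (MAX i\<in>{..<d}. cmod (v i))"

definition contraction_to_linf :: "nat \<Rightarrow> ('a::complex_normed_vector \<Rightarrow> nat \<Rightarrow> complex) \<Rightarrow> bool" where
  "contraction_to_linf d \<phi> \<longleftrightarrow>
     (\<forall>x. \<phi> x \<in> linf_space d) \<and>
     (\<forall>x y. \<phi> (x + y) = (\<lambda>i. \<phi> x i + \<phi> y i)) \<and>
     (\<forall>c x. \<phi> (c *\<^sub>C x) = (\<lambda>i. c * \<phi> x i)) \<and>
     (\<forall>x. linf_norm d (\<phi> x) \<le> norm x)"

definition contraction_from_linf :: "nat \<Rightarrow> ((nat \<Rightarrow> complex) \<Rightarrow> 'b::complex_normed_vector) \<Rightarrow> bool" where
  "contraction_from_linf d \<psi> \<longleftrightarrow>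
     (\<forall>v\<in>linf_space d. \<forall>w\<in>linf_space d. \<psi> (\<lambda>i. v i + w i) = \<psi> v + \<psi> w) \<and>
     (\<forall>c. \<forall>v\<in>linf_space d. \<psi> (\<lambda>i. c * v i) = c *\<^sub>C \<psi> v) \<and>
     (\<forall>v\<in>linf_space d. norm (\<psi> v) \<le> linf_norm d v)"

definition CA ::
    "('a::complex_banach \<Rightarrow> 'b::complex_banach) \<Rightarrow> 'a set \<Rightarrow> real
       \<Rightarrow> (('a \<Rightarrow> nat \<Rightarrow> complex) \<times> ((nat \<Rightarrow> complex) \<Rightarrow> 'b) \<times> nat) set" where
  "CA \<gamma> \<Omega> \<delta> = {(\<phi>, \<psi>, d).
     d > 0 \<and> contraction_to_linf d \<phi> \<and> contraction_from_linf d \<psi> \<and>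
     (\<forall>x\<in>\<Omega>. norm (\<psi> (\<phi> x) - \<gamma> x) < \<delta>)}"

definition CA_embedding :: "('a::complex_banach \<Rightarrow> 'b::complex_banach) \<Rightarrow> bool" where
  "CA_embedding \<iota> \<longleftrightarrow> clinear \<iota> \<and> isometric \<iota> \<and>
     (\<forall>\<Omega> \<delta>. finite \<Omega> \<longrightarrow> \<delta> > 0 \<longrightarrow> CA \<iota> \<Omega> \<delta> \<noteq> {})"

text \<open>The value of \<open>rc\<close>, and hence of the entropies below, does not depend on the CA embedding
  \<open>\<iota>\<close>. That is a theorem about all Banach spaces, so \<open>\<iota>\<close> is kept as an explicit parameter here.\<close>

definition rc :: "('a::complex_banach \<Rightarrow> 'b::complex_banach) \<Rightarrow> 'a set \<Rightarrow> real \<Rightarrow> nat" where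
  "rc \<iota> \<Omega> \<delta> = Inf {d. \<exists>\<phi> \<psi>. (\<phi>, \<psi>, d) \<in> CA \<iota> \<Omega> \<delta>}"

definition hc_set_tol ::
    "('a::complex_banach \<Rightarrow> 'b::complex_banach) \<Rightarrow> ('a \<Rightarrow> 'a) \<Rightarrow> 'a set \<Rightarrow> real \<Rightarrow> ereal" where
  "hc_set_tol \<iota> \<alpha> \<Omega> \<delta> =
     limsup (\<lambda>n. ereal (1 / real n * ln (real (rc \<iota> (\<Union>k<n. (\<alpha> ^^ k) ` \<Omega>) \<delta>))))"

definition hc_set ::
    "('a::complex_banach \<Rightarrow> 'b::complex_banach) \<Rightarrow> ('a \<Rightarrow> 'a) \<Rightarrow> 'a set \<Rightarrow> ereal" where
  "hc_set \<iota> \<alpha> \<Omega> = (SUP \<delta>\<in>{0<..}. hc_set_tol \<iota> \<alpha> \<Omega> \<delta>)"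

definition hc :: "('a::complex_banach \<Rightarrow> 'b::complex_banach) \<Rightarrow> ('a \<Rightarrow> 'a) \<Rightarrow> ereal" where
  "hc \<iota> \<alpha> = (SUP \<Omega>\<in>{\<Omega>. finite \<Omega>}. hc_set \<iota> \<alpha> \<Omega>)"


section \<open>The space \<open>\<ell>\<^sub>1\<close>\<close>

no_notation Infinite_Set_Sum.abs_summable_on (infix \<open>abs'_summable'_on\<close> 50)

typedef 'i ell1 = "{x :: 'i \<Rightarrow> complex. x abs_summable_on UNIV}"
  morphisms ell1_apply Abs_ell1
  by (rule exI[of _ "\<lambda>_. 0"]) simp

setup_lifting type_definition_ell1

lemma ell1_eqI: "(\<And>s. ell1_apply x s = ell1_apply y s) \<Longrightarrow> x = y"
  by (simp add: ell1_apply_inject[symmetric] fun_eq_iff)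

lemma ell1_abs_summable: "ell1_apply x abs_summable_on UNIV"
  using ell1_apply[of x] by simp

lemma abs_summable_plus:
  fixes x y :: "'i \<Rightarrow> complex"
  assumes "x abs_summable_on UNIV" "y abs_summable_on UNIV"
  shows "(\<lambda>s. x s + y s) abs_summable_on UNIV"
  by (rule Infinite_Sum.abs_summable_on_comparison_test'[OF summable_on_add[OF assms]])
     (rule norm_triangle_ineq)

instantiation ell1 :: (type) real_vector
begin

lift_definition zero_ell1 :: "'a ell1" is "\<lambda>_. 0"
  by simp

lift_definition plus_ell1 :: "'a ell1 \<Rightarrow> 'a ell1 \<Rightarrow> 'a ell1" is "\<lambda>x y s. x s + y s"
  by (rule abs_summable_plus)

lift_definition uminus_ell1 :: "'a ell1 \<Rightarrow> 'a ell1" is "\<lambda>x s. - x s"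
  by simp

lift_definition minus_ell1 :: "'a ell1 \<Rightarrow> 'a ell1 \<Rightarrow> 'a ell1" is "\<lambda>x y s. x s - y s"
  using abs_summable_plus[where y = "\<lambda>s. - y s" for y] by simp

lift_definition scaleR_ell1 :: "real \<Rightarrow> 'a ell1 \<Rightarrow> 'a ell1" is "\<lambda>r x s. r *\<^sub>R x s"
  by (simp add: summable_on_cmult_right)

instance
proof
  fix x y z :: "'a ell1" and a b :: real
  show "x + y + z = x + (y + z)" by transfer (simp add: add.assoc)
  show "x + y = y + x" by transfer (simp add: add.commute)
  show "0 + x = x" by transfer simp
  show "- x + x = 0" by transfer simp
  show "x - y = x + - y" by transfer simp
  show "a *\<^sub>R (x + y) = a *\<^sub>R x + a *\<^sub>R y" by transfer (simp add: scaleR_add_right)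
  show "(a + b) *\<^sub>R x = a *\<^sub>R x + b *\<^sub>R x" by transfer (simp add: scaleR_add_left)
  show "a *\<^sub>R b *\<^sub>R x = (a * b) *\<^sub>R x" by transfer simp
  show "1 *\<^sub>R x = x" by transfer simp
qed

end

instantiation ell1 :: (type) complex_normed_vector
begin

lift_definition scaleC_ell1 :: "complex \<Rightarrow> 'a ell1 \<Rightarrow> 'a ell1" is "\<lambda>c x s. c * x s"
  by (simp add: norm_mult summable_on_cmult_right)

lift_definition norm_ell1 :: "'a ell1 \<Rightarrow> real" is "\<lambda>x. \<Sum>\<^sub>\<infinity>s. cmod (x s)" .

definition dist_ell1 :: "'a ell1 \<Rightarrow> 'a ell1 \<Rightarrow> real" where
  "dist_ell1 x y = norm (x - y)"

definition sgn_ell1 :: "'a ell1 \<Rightarrow> 'a ell1" where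
  "sgn_ell1 x = x /\<^sub>R norm x"

definition uniformity_ell1 :: "('a ell1 \<times> 'a ell1) filter" where
  "uniformity_ell1 = (INF e\<in>{0<..}. principal {(x, y). dist x y < e})"

definition open_ell1 :: "'a ell1 set \<Rightarrow> bool" where
  "open_ell1 U \<longleftrightarrow> (\<forall>x\<in>U. \<forall>\<^sub>F (x', y) in uniformity. x' = x \<longrightarrow> y \<in> U)"

instance
proof
  fix x y :: "'a ell1" and a :: real and c d :: complex
  show "dist x y = norm (x - y)" by (rule dist_ell1_def)
  show "sgn x = x /\<^sub>R norm x" by (rule sgn_ell1_def)
  show "(uniformity :: ('a ell1 \<times> 'a ell1) filter)
      = (INF e\<in>{0<..}. principal {(x, y). dist x y < e})" by (rule uniformity_ell1_def)
  show "open U \<longleftrightarrow> (\<forall>x\<in>U. \<forall>\<^sub>F (x', y) in uniformity. x' = x \<longrightarrow> y \<in> U)"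
    for U :: "'a ell1 set" by (rule open_ell1_def)
  show "norm x = 0 \<longleftrightarrow> x = 0"
  proof
    assume "norm x = 0"
    then have "cmod (ell1_apply x s) = 0" for s
      by (intro nonneg_infsum_le_0D[OF _ ell1_abs_summable[of x]]) (simp_all add: norm_ell1.rep_eq)
    then show "x = 0" by (intro ell1_eqI) (simp add: zero_ell1.rep_eq)
  qed (simp add: norm_ell1.rep_eq zero_ell1.rep_eq)
  show "norm (x + y) \<le> norm x + norm y"
  proof -
    note xy = ell1_abs_summable[of x] ell1_abs_summable[of y]
    have "norm (x + y) \<le> (\<Sum>\<^sub>\<infinity>s. cmod (ell1_apply x s) + cmod (ell1_apply y s))"
      unfolding norm_ell1.rep_eq plus_ell1.rep_eq
      by (intro infsum_mono summable_on_add abs_summable_plus norm_triangle_ineq xy)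
    also have "\<dots> = norm x + norm y"
      unfolding norm_ell1.rep_eq by (rule infsum_add[OF xy])
    finally show ?thesis .
  qed
  show "norm (a *\<^sub>R x) = \<bar>a\<bar> * norm x" by transfer (simp add: infsum_cmult_right')
  show "c *\<^sub>C (x + y) = c *\<^sub>C x + c *\<^sub>C y" by transfer (simp add: distrib_left)
  show "(c + d) *\<^sub>C x = c *\<^sub>C x + d *\<^sub>C x" by transfer (simp add: distrib_right)
  show "c *\<^sub>C d *\<^sub>C x = (c * d) *\<^sub>C x" by transfer (simp add: mult.assoc)
  show "a *\<^sub>R x = complex_of_real a *\<^sub>C x" by transfer (simp add: scaleR_conv_of_real)
  show "norm (c *\<^sub>C x) = cmod c * norm x" by transfer (simp add: norm_mult infsum_cmult_right')
qed

end

lemma sum_cmod_le_norm_ell1: "finite F \<Longrightarrow> (\<Sum>s\<in>F. cmod (ell1_apply x s)) \<le> norm x"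
  using finite_sum_le_infsum[OF ell1_abs_summable[of x], of F] by (simp add: norm_ell1.rep_eq)

instance ell1 :: (type) complex_banach
proof
  fix X :: "nat \<Rightarrow> 'a ell1"
  assume X: "Cauchy X"
  have "Cauchy (\<lambda>n. ell1_apply (X n) s)" for s
  proof (rule metric_CauchyI)
    fix e :: real assume "e > 0"
    then obtain M where M: "\<And>m n. m \<ge> M \<Longrightarrow> n \<ge> M \<Longrightarrow> norm (X m - X n) < e"
      using X unfolding Cauchy_def dist_norm by meson
    have "dist (ell1_apply (X m) s) (ell1_apply (X n) s) < e" if "m \<ge> M" "n \<ge> M" for m n
      using sum_cmod_le_norm_ell1[of "{s}" "X m - X n"] M[OF that]
      by (simp add: minus_ell1.rep_eq dist_norm)
    then show "\<exists>M. \<forall>m\<ge>M. \<forall>n\<ge>M. dist (ell1_apply (X m) s) (ell1_apply (X n) s) < e" by blast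
  qed
  then obtain f where f: "\<And>s. (\<lambda>n. ell1_apply (X n) s) \<longlonglongrightarrow> f s"
    unfolding Cauchy_convergent_iff convergent_def by metis
  have tail: "\<exists>M. \<forall>n\<ge>M. \<forall>F. finite F \<longrightarrow> (\<Sum>s\<in>F. cmod (ell1_apply (X n) s - f s)) \<le> e"
    if e: "e > 0" for e :: real
  proof -
    obtain M where M: "\<And>m n. m \<ge> M \<Longrightarrow> n \<ge> M \<Longrightarrow> norm (X m - X n) < e"
      using X e unfolding Cauchy_def dist_norm by meson
    have "(\<Sum>s\<in>F. cmod (ell1_apply (X n) s - f s)) \<le> e" if n: "n \<ge> M" and F: "finite F" for n F
    proof (rule tendsto_upperbound)
      show "(\<lambda>m. \<Sum>s\<in>F. cmod (ell1_apply (X n) s - ell1_apply (X m) s))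
              \<longlonglongrightarrow> (\<Sum>s\<in>F. cmod (ell1_apply (X n) s - f s))"
        by (intro tendsto_intros f)
      show "\<forall>\<^sub>F m in sequentially. (\<Sum>s\<in>F. cmod (ell1_apply (X n) s - ell1_apply (X m) s)) \<le> e"
      proof (rule eventually_sequentiallyI[of M])
        fix m assume "m \<ge> M"
        then show "(\<Sum>s\<in>F. cmod (ell1_apply (X n) s - ell1_apply (X m) s)) \<le> e"
          using sum_cmod_le_norm_ell1[OF F, of "X n - X m"] M[OF n, of m]
          by (simp add: minus_ell1.rep_eq)
      qed
    qed simp
    then show ?thesis by blast
  qed
  obtain M where M: "\<And>F. finite F \<Longrightarrow> (\<Sum>s\<in>F. cmod (ell1_apply (X M) s - f s)) \<le> 1"
    using tail[of 1] by auto
  have diff: "(\<lambda>s. ell1_apply (X M) s - f s) abs_summable_on UNIV"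
    by (rule nonneg_bdd_above_summable_on) (auto intro!: bdd_aboveI2[where M = 1] M)
  have "(\<lambda>s. ell1_apply (X M) s + - (ell1_apply (X M) s - f s)) abs_summable_on UNIV"
    by (intro abs_summable_plus ell1_abs_summable) (use diff in \<open>simp add: norm_minus_commute\<close>)
  then have "f abs_summable_on UNIV" by simp
  then obtain L where L: "ell1_apply L = f" using Abs_ell1_inverse[of f] by auto
  have "X \<longlonglongrightarrow> L"
  proof (rule LIMSEQ_I)
    fix e :: real assume e: "e > 0"
    obtain M where M: "\<And>n F. n \<ge> M \<Longrightarrow> finite F \<Longrightarrow> (\<Sum>s\<in>F. cmod (ell1_apply (X n) s - f s)) \<le> e / 2"
      using tail[of "e / 2"] e by auto
    have "norm (X n - L) \<le> e / 2" if "n \<ge> M" for n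
      unfolding norm_ell1.rep_eq
      by (rule infsum_le_finite_sums[OF ell1_abs_summable])
         (use M[OF that] in \<open>simp add: minus_ell1.rep_eq L\<close>)
    then show "\<exists>no. \<forall>n\<ge>no. norm (X n - L) < e" using e by fastforce
  qed
  then show "convergent X" by (rule convergentI)
qed


section \<open>The permutation associated with an isometric automorphism\<close>

definition associated_permutation :: "('i ell1 \<Rightarrow> 'i ell1) \<Rightarrow> ('i \<Rightarrow> 'i) \<Rightarrow> bool" where
  "associated_permutation \<alpha> \<sigma> \<longleftrightarrow> bij \<sigma> \<and>
     (\<exists>lam :: 'i \<Rightarrow> complex. (\<forall>s. cmod (lam s) = 1) \<and>
          (\<forall>x s. ell1_apply (\<alpha> x) s = lam s * ell1_apply x (\<sigma> s)))"

text \<open>The orbit under the full group generated by \<open>\<sigma>\<close>, not only under its positive powers.\<close>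

definition perm_orbit :: "('i \<Rightarrow> 'i) \<Rightarrow> 'i \<Rightarrow> 'i set" where
  "perm_orbit \<sigma> s = range (\<lambda>n. (\<sigma> ^^ n) s) \<union> range (\<lambda>n. (inv \<sigma> ^^ n) s)"


section \<open>Existence of a CA embedding of \<open>\<ell>\<^sub>1\<close>\<close>

instantiation complex :: complex_banach
begin

definition scaleC_complex :: "complex \<Rightarrow> complex \<Rightarrow> complex" where
  "scaleC_complex c z = c * z"

instance
  by standard (simp_all add: scaleC_complex_def algebra_simps scaleR_conv_of_real norm_mult)

end

instantiation bcontfun :: (metric_space, complex_normed_vector) complex_normed_vector
begin

definition scaleC_bcontfun :: "complex \<Rightarrow> ('a \<Rightarrow>\<^sub>C 'b) \<Rightarrow> 'a \<Rightarrow>\<^sub>C 'b" where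
  "scaleC_bcontfun c f = Bcontfun (\<lambda>k. c *\<^sub>C apply_bcontfun f k)"

lemma apply_scaleC_bcontfun:
  "apply_bcontfun (c *\<^sub>C f) k = c *\<^sub>C apply_bcontfun (f :: 'a \<Rightarrow>\<^sub>C 'b) k"
proof -
  have bl: "bounded_linear (\<lambda>x::'b. c *\<^sub>C x)"
    by (rule bounded_linear_intro[where K = "cmod c"])
       (simp_all add: scaleC_add_right scaleR_scaleC scaleC_scaleC norm_scaleC mult.commute)
  have "(\<lambda>k. c *\<^sub>C apply_bcontfun f k) \<in> bcontfun"
    using bounded_linear.continuous_on[OF bl continuous_on_apply_bcontfun[of UNIV f]]
      bounded_linear_image[OF bounded_apply_bcontfun[of f] bl]
    by (simp add: bcontfun_def image_image)
  then show ?thesis by (simp add: scaleC_bcontfun_def Bcontfun_inverse)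
qed

instance
proof
  fix f g :: "'a \<Rightarrow>\<^sub>C 'b" and c d :: complex and r :: real
  show "c *\<^sub>C (f + g) = c *\<^sub>C f + c *\<^sub>C g"
    by (rule bcontfun_eqI) (simp add: apply_scaleC_bcontfun scaleC_add_right)
  show "(c + d) *\<^sub>C f = c *\<^sub>C f + d *\<^sub>C f"
    by (rule bcontfun_eqI) (simp add: apply_scaleC_bcontfun scaleC_add_left)
  show *: "c *\<^sub>C d *\<^sub>C f = (c * d) *\<^sub>C f" for c d and f :: "'a \<Rightarrow>\<^sub>C 'b"
    by (rule bcontfun_eqI) (simp add: apply_scaleC_bcontfun scaleC_scaleC)
  show **: "r *\<^sub>R f = complex_of_real r *\<^sub>C f" for r and f :: "'a \<Rightarrow>\<^sub>C 'b"
    by (rule bcontfun_eqI) (simp add: apply_scaleC_bcontfun scaleR_scaleC)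
  have le: "norm (c *\<^sub>C f) \<le> cmod c * norm f" for c and f :: "'a \<Rightarrow>\<^sub>C 'b"
    by (rule norm_bound)
       (simp add: apply_scaleC_bcontfun norm_scaleC mult_left_mono norm_bounded)
  show "norm (c *\<^sub>C f) = cmod c * norm f"
  proof (cases "c = 0")
    case True
    then show ?thesis using le[of c f] by simp
  next
    case False
    have "f = inverse c *\<^sub>C c *\<^sub>C f" using False **[of 1 f, symmetric] by (simp add: *)
    then have "norm f \<le> cmod (inverse c) * norm (c *\<^sub>C f)" by (metis le)
    then have "cmod c * norm f \<le> norm (c *\<^sub>C f)"
      using False by (simp add: norm_inverse norm_divide field_simps)
    then show ?thesis using le[of c f] by simp
  qed
qed

end

instance bcontfun :: (metric_space, complex_banach) complex_banach ..

lemma bcontfun_discrete: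
  fixes f :: "'k discrete \<Rightarrow> 'b::real_normed_vector"
  assumes "\<And>k. norm (f k) \<le> B"
  shows "f \<in> bcontfun"
  by (rule bcontfun_normI[OF _ assms]) (simp add: continuous_on_open_vimage open_discrete)

lemma finite_partition_small_oscillation:
  fixes \<F> :: "('k::metric_space \<Rightarrow>\<^sub>C complex) set"
  assumes "finite \<F>" "\<delta> > 0"
  shows "\<exists>(g :: 'k \<Rightarrow> nat) d. (\<forall>k. g k < d) \<and>
    (\<forall>f\<in>\<F>. \<forall>k k'. g k = g k' \<longrightarrow> cmod (apply_bcontfun f k - apply_bcontfun f k') \<le> \<delta>)"
  using assms(1)
proof (induction \<F> rule: finite_induct)
  case empty
  show ?case by (rule exI[of _ "\<lambda>_. 0"], rule exI[of _ 1]) simp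
next
  case (insert f \<F>)
  then obtain g :: "'k \<Rightarrow> nat" and d where g: "\<And>k. g k < d"
    "\<And>f k k'. f \<in> \<F> \<Longrightarrow> g k = g k' \<Longrightarrow> cmod (apply_bcontfun f k - apply_bcontfun f k') \<le> \<delta>"
    by metis
  have "compact (closure (range (apply_bcontfun f)))" by simp
  then obtain C where C: "finite C" "closure (range (apply_bcontfun f)) \<subseteq> (\<Union>z\<in>C. ball z (\<delta>/2))"
    unfolding compact_eq_totally_bounded using assms(2) by (metis half_gt_zero)
  have "\<exists>z\<in>C. dist z (apply_bcontfun f k) < \<delta>/2" for k
    using C(2) closure_subset[of "range (apply_bcontfun f)"] by fastforce
  then obtain q where q: "\<And>k. q k \<in> C" "\<And>k. dist (q k) (apply_bcontfun f k) < \<delta>/2" by metis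
  obtain e :: "complex \<Rightarrow> nat" and m where e: "e ` C = {i. i < m}" "inj_on e C"
    using finite_imp_inj_to_nat_seg[OF C(1)] by metis
  have em: "e (q k) < m" for k using e(1) q(1)[of k] by blast
  define h where "h k = g k * m + e (q k)" for k
  have dec: "h k div m = g k" "h k mod m = e (q k)" for k
    using em[of k] by (simp_all add: h_def)
  have "h k < d * m" for k
  proof -
    have "h k < (g k + 1) * m" using em[of k] by (simp add: h_def)
    also have "\<dots> \<le> d * m" using g(1)[of k] by (intro mult_right_mono) auto
    finally show ?thesis .
  qed
  moreover have "cmod (apply_bcontfun f' k - apply_bcontfun f' k') \<le> \<delta>"
    if "f' \<in> insert f \<F>" and h: "h k = h k'" for f' k k'
  proof (cases "f' \<in> \<F>")
    case True
    then show ?thesis using g(2) h dec(1) by metis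
  next
    case False
    have "q k = q k'" using h dec(2) e(2) q(1) by (metis inj_onD)
    then have "dist (apply_bcontfun f k) (apply_bcontfun f k') < \<delta>"
      using q(2)[of k] q(2)[of k'] dist_triangle_half_r by metis
    then show ?thesis using that(1) False by (simp add: dist_norm)
  qed
  ultimately show ?case by blast
qed

lemma CA_embedding_into_bounded_functions:
  fixes \<iota> :: "'a::complex_banach \<Rightarrow> 'k discrete \<Rightarrow>\<^sub>C complex"
  assumes lin: "clinear \<iota>" and iso: "isometric \<iota>"
  shows "CA_embedding \<iota>"
proof -
  have "CA \<iota> \<Omega> \<delta> \<noteq> {}" if fin: "finite \<Omega>" and \<delta>: "\<delta> > 0" for \<Omega> \<delta>
  proof -
    obtain g :: "'k discrete \<Rightarrow> nat" and d where gd: "\<And>k. g k < d"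
      and g: "\<And>x k k'. x \<in> \<Omega> \<Longrightarrow> g k = g k' \<Longrightarrow>
        cmod (apply_bcontfun (\<iota> x) k - apply_bcontfun (\<iota> x) k') \<le> \<delta>/2"
      using finite_partition_small_oscillation[of "\<iota> ` \<Omega>" "\<delta>/2"] fin \<delta>
      by (metis finite_imageI half_gt_zero imageI)
    have d: "d > 0" using gd[of undefined] by simp
    define r where "r i = (SOME k. g k = i)" for i
    have r: "g (r (g k)) = g k" for k unfolding r_def by (rule someI) simp
    define \<phi> where "\<phi> x i = (if i < d then apply_bcontfun (\<iota> x) (r i) else 0)" for x i
    define \<psi> :: "(nat \<Rightarrow> complex) \<Rightarrow> 'k discrete \<Rightarrow>\<^sub>C complex"
      where "\<psi> v = Bcontfun (\<lambda>k. v (g k))" for v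
    have vle: "cmod (v (g k)) \<le> linf_norm d v" for v k
      unfolding linf_norm_def using gd[of k] by (intro Max_ge) auto
    have \<psi>: "apply_bcontfun (\<psi> v) k = v (g k)" for v k
      unfolding \<psi>_def by (subst Bcontfun_inverse) (auto intro: bcontfun_discrete vle)
    have "contraction_to_linf d \<phi>"
      unfolding contraction_to_linf_def
    proof (intro conjI allI)
      fix x y :: 'a and c :: complex
      show "\<phi> x \<in> linf_space d" by (simp add: linf_space_def \<phi>_def)
      show "\<phi> (x + y) = (\<lambda>i. \<phi> x i + \<phi> y i)"
        using lin by (auto simp: \<phi>_def clinear_def)
      show "\<phi> (c *\<^sub>C x) = (\<lambda>i. c * \<phi> x i)"
        using lin by (auto simp: \<phi>_def clinear_def apply_scaleC_bcontfun scaleC_complex_def)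
      show "linf_norm d (\<phi> x) \<le> norm x"
        unfolding linf_norm_def using d iso norm_bounded[of "\<iota> x"]
        by (intro Max.boundedI) (auto simp: \<phi>_def isometric_def)
    qed
    moreover have "contraction_from_linf d \<psi>"
      unfolding contraction_from_linf_def
      by (auto intro!: bcontfun_eqI norm_bound simp: \<psi> vle apply_scaleC_bcontfun scaleC_complex_def)
    moreover have "norm (\<psi> (\<phi> x) - \<iota> x) < \<delta>" if "x \<in> \<Omega>" for x
    proof -
      have "norm (\<psi> (\<phi> x) - \<iota> x) \<le> \<delta>/2"
        by (rule norm_bound) (use g[OF that r] gd in \<open>simp add: \<psi> \<phi>_def\<close>)
      then show ?thesis using \<delta> by simp
    qed
    ultimately have "(\<phi>, \<psi>, d) \<in> CA \<iota> \<Omega> \<delta>" using d by (simp add: CA_def)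
    then show ?thesis by blast
  qed
  then show ?thesis using lin iso by (simp add: CA_embedding_def)
qed

theorem CA_embedding_ell1_exists:
  "\<exists>\<iota> :: 'i ell1 \<Rightarrow> ('i \<Rightarrow> complex) discrete \<Rightarrow>\<^sub>C complex. CA_embedding \<iota>"
proof -
  define p where "p x k s = ell1_apply x s * sgn (of_discrete k s)"
    for x :: "'i ell1" and k :: "('i \<Rightarrow> complex) discrete" and s
  have ple: "cmod (p x k s) \<le> cmod (ell1_apply x s)" for x k s
    by (simp add: p_def norm_mult norm_sgn)
  have pabs: "p x k abs_summable_on UNIV" for x k
    by (rule Infinite_Sum.abs_summable_on_comparison_test[OF ell1_abs_summable ple])
  note psum = abs_summable_summable[OF pabs]
  have bound: "cmod (\<Sum>\<^sub>\<infinity>s. p x k s) \<le> norm x" for x k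
  proof -
    have "cmod (\<Sum>\<^sub>\<infinity>s. p x k s) \<le> (\<Sum>\<^sub>\<infinity>s. cmod (p x k s))" by (rule norm_infsum_bound[OF pabs])
    also have "\<dots> \<le> norm x"
      unfolding norm_ell1.rep_eq by (rule infsum_mono[OF pabs ell1_abs_summable ple])
    finally show ?thesis .
  qed
  define \<iota> where "\<iota> x = Bcontfun (\<lambda>k. \<Sum>\<^sub>\<infinity>s. p x k s)" for x
  have \<iota>: "apply_bcontfun (\<iota> x) k = (\<Sum>\<^sub>\<infinity>s. p x k s)" for x k
    unfolding \<iota>_def by (subst Bcontfun_inverse) (auto intro: bcontfun_discrete bound)
  have "clinear \<iota>"
    unfolding clinear_def
  proof (intro conjI allI; rule bcontfun_eqI)
    fix x y k
    have "(\<Sum>\<^sub>\<infinity>s. p (x + y) k s) = (\<Sum>\<^sub>\<infinity>s. p x k s + p y k s)"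
      by (rule infsum_cong) (simp add: p_def plus_ell1.rep_eq distrib_right)
    also have "\<dots> = (\<Sum>\<^sub>\<infinity>s. p x k s) + (\<Sum>\<^sub>\<infinity>s. p y k s)" by (rule infsum_add[OF psum psum])
    finally show "apply_bcontfun (\<iota> (x + y)) k = apply_bcontfun (\<iota> x + \<iota> y) k" by (simp add: \<iota>)
  next
    fix c x k
    have "(\<Sum>\<^sub>\<infinity>s. p (c *\<^sub>C x) k s) = (\<Sum>\<^sub>\<infinity>s. c * p x k s)"
      by (rule infsum_cong) (simp add: p_def scaleC_ell1.rep_eq mult.assoc)
    then show "apply_bcontfun (\<iota> (c *\<^sub>C x)) k = apply_bcontfun (c *\<^sub>C \<iota> x) k"
      by (simp add: \<iota> apply_scaleC_bcontfun scaleC_complex_def infsum_cmult_right')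
  qed
  moreover have "isometric \<iota>"
    unfolding isometric_def
  proof (intro allI antisym)
    fix x
    show "norm (\<iota> x) \<le> norm x" by (rule norm_bound) (simp add: \<iota> bound)
    define k where "k = discrete (\<lambda>s. cnj (ell1_apply x s))"
    have "p x k s = complex_of_real (cmod (ell1_apply x s))" for s
      by (simp add: p_def k_def discrete_inverse sgn_div_norm scaleR_conv_of_real
          complex_norm_square[symmetric] power2_eq_square field_simps)
    then have "apply_bcontfun (\<iota> x) k = (\<Sum>\<^sub>\<infinity>s. complex_of_real (cmod (ell1_apply x s)))"
      by (simp add: \<iota>)
    also have "\<dots> = complex_of_real (norm x)"
      using infsumI[OF has_sum_of_real_iff[THEN iffD2, OF has_sum_infsum[OF ell1_abs_summable[of x]]]]
      by (simp add: norm_ell1.rep_eq)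
    finally show "norm x \<le> norm (\<iota> x)" using norm_bounded[of "\<iota> x" k] by simp
  qed
  ultimately show ?thesis using CA_embedding_into_bounded_functions by blast
qed

end

theory Submission
  imports Defs
begin

text \<open>
  Let \<open>e\<^sub>t\<close> be the unit vector at \<open>t\<close>.  An automorphism with associated permutation \<open>\<sigma>\<close> moves the
  coordinates of a vector along \<open>\<sigma>\<close> and changes their phases, so it respects moduli.

  \<^bold>\<open>Infinite orbit.\<close>  If the orbit of \<open>t\<close> is infinite, the vectors \<open>\<alpha>\<^sup>k e\<^sub>t\<close> for \<open>k < n\<close> sit on distinct
  coordinates and hence span an isometric copy of the \<open>n\<close>-dimensional \<open>\<ell>\<^sub>1\<close>.  A contractive
  factorization through \<open>\<ell>\<^sub>\<infinity>\<^sup>d\<close> with error \<open>\<delta>\<close> on these vectors has error at most \<open>n \<delta>\<close> on each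
  combination \<open>\<Sum> u\<^sub>k \<alpha>\<^sup>k e\<^sub>t\<close> with unimodular \<open>u\<^sub>k\<close>, which has norm \<open>n\<close>.  So one of the \<open>d\<close>
  coordinate functionals takes a value of modulus at least \<open>(1 - \<delta>) n\<close> there, which determines almost all of
  the \<open>u\<^sub>k\<close> up to a common phase.  Over the complex scalars the \<open>u\<^sub>k\<close> may range over any finite
  set of phases, and when \<open>\<delta>\<close> is small compared with the gaps in that set each functional serves
  only a small fraction of the choices.  The count in \<open>norming_functionals_exponential\<close> gives
  \<open>m\<^sup>n \<le> C d\<close> for any prescribed \<open>m\<close>, with \<open>\<delta>\<close> and \<open>C\<close> depending on \<open>m\<close> alone.  Therefore the
  entropy is at least \<open>ln m\<close> for every \<open>m\<close>.

  \<^bold>\<open>Finite orbits.\<close>  If all orbits are finite, a finite \<open>\<Omega>\<close> is nearly supported on a finite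
  \<open>\<sigma>\<close>-invariant set \<open>E\<close>, and by invariance so are all its images \<open>\<alpha>\<^sup>k \<Omega>\<close>.  One factorization that is
  accurate on the unit vectors \<open>e\<^sub>s\<close> with \<open>s \<in> E\<close> is accurate on every bounded combination of
  them, so it serves all \<open>\<alpha>\<^sup>k \<Omega>\<close> at once (\<open>rc_orbit_bounded\<close>).  Thus \<open>rc\<close> stays bounded in \<open>n\<close>
  and the entropy vanishes.
\<close>

section \<open>Counting the norming functionals of a finite-dimensional \<open>\<ell>\<^sub>1\<close>-space\<close>

text \<open>If \<open>c\<close> lies in the unit disc and \<open>u\<close> is unimodular, then \<open>Re (c * u)\<close> close to \<open>1\<close> forces \<open>c\<close> to be
  close to \<open>cnj u\<close>.  Distinct elements of a finite set have a positive distance, so \<open>c\<close> cannot be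
  close to two of them.\<close>

lemma separated_phases_at_most_one_aligned:
  fixes U :: "complex set"
  assumes fin: "finite U" and U: "\<And>u. u \<in> U \<Longrightarrow> cmod u = 1"
  shows "\<exists>\<eta>>0. \<forall>c. cmod c \<le> 1 \<longrightarrow> (\<forall>u\<in>U. \<forall>v\<in>U.
           Re (c * u) > 1 - \<eta> \<longrightarrow> Re (c * v) > 1 - \<eta> \<longrightarrow> u = v)"
proof -
  obtain D where D: "D > 0" "\<And>u v. u \<in> U \<Longrightarrow> v \<in> U \<Longrightarrow> u \<noteq> v \<Longrightarrow> D \<le> dist u v"
  proof (cases "{dist u v |u v. u \<in> U \<and> v \<in> U \<and> u \<noteq> v} = {}")
    case True
    then show thesis using that[of 1] by auto
  next
    case False
    let ?S = "{dist u v |u v. u \<in> U \<and> v \<in> U \<and> u \<noteq> v}"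
    have S: "finite ?S"
      by (rule finite_subset[of _ "(\<lambda>(u, v). dist u v) ` (U \<times> U)"]) (use fin in auto)
    show thesis
    proof (rule that[of "Min ?S"])
      show "Min ?S > 0" using S False by (subst Min_gr_iff) auto
      show "\<And>u v. u \<in> U \<Longrightarrow> v \<in> U \<Longrightarrow> u \<noteq> v \<Longrightarrow> Min ?S \<le> dist u v"
        using S by (intro Min_le) auto
    qed
  qed
  have near: "cmod (c - cnj u) < D / 2"
    if c: "cmod c \<le> 1" and u: "u \<in> U" and *: "Re (c * u) > 1 - D\<^sup>2 / 8" for c u
  proof -
    have "u * cnj u = 1" using complex_norm_square[of u] U[OF u] by simp
    then have "(c - cnj u) * u = c * u - 1" by (simp add: algebra_simps)
    then have "cmod (c - cnj u) = cmod (c * u - 1)" using U[OF u] by (metis norm_mult mult.right_neutral)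
    then have "(cmod (c - cnj u))\<^sup>2 = (cmod (c * u - 1))\<^sup>2" by simp
    also have "\<dots> = (cmod (c * u))\<^sup>2 + 1 - 2 * Re (c * u)"
      unfolding cmod_power2 by (simp add: power2_eq_square algebra_simps)
    also have "\<dots> \<le> 2 - 2 * Re (c * u)"
      using c U[OF u] power_mono[OF c, of 2] by (simp add: norm_mult)
    also have "\<dots> < (D / 2)\<^sup>2" using * by (simp add: power_divide)
    finally show ?thesis using D(1) power2_less_imp_less[of "cmod (c - cnj u)" "D / 2"] by simp
  qed
  have "u = v" if "cmod c \<le> 1" "u \<in> U" "v \<in> U"
    "Re (c * u) > 1 - D\<^sup>2 / 8" "Re (c * v) > 1 - D\<^sup>2 / 8" for c u v
  proof (rule ccontr)
    assume "u \<noteq> v"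
    then have "D \<le> cmod (u - v)" using D(2) that by (simp add: dist_norm)
    also have "\<dots> = cmod (cnj u - cnj v)" by (metis complex_cnj_diff complex_mod_cnj)
    also have "\<dots> \<le> cmod (c - cnj u) + cmod (c - cnj v)"
      using norm_triangle_ineq4[of "c - cnj v" "c - cnj u"] by (simp add: add.commute)
    also have "\<dots> < D" using near that by (metis add_strict_mono field_sum_of_halves)
    finally show False by simp
  qed
  then show ?thesis using D(1) by (intro exI[of _ "D\<^sup>2 / 8"]) auto
qed

text \<open>The weight \<open>exp (- s * (1 - Re (c * u)))\<close> penalises phases \<open>u\<close> that \<open>c\<close> does not align with the
  positive axis.  At most one phase is aligned and contributes at most \<open>1\<close>, each other one at most
  \<open>exp (- s * \<eta>)\<close>; for large \<open>s\<close> the total weight is therefore bounded independently of the size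
  of \<open>U\<close>.\<close>

lemma exp_defect_sum_le:
  fixes U :: "complex set"
  assumes fin: "finite U" and s: "s \<ge> 0"
    and one: "\<And>u v. u \<in> U \<Longrightarrow> v \<in> U \<Longrightarrow> Re (c * u) > 1 - \<eta> \<Longrightarrow> Re (c * v) > 1 - \<eta> \<Longrightarrow> u = v"
    and le: "\<And>u. u \<in> U \<Longrightarrow> Re (c * u) \<le> 1"
  shows "(\<Sum>u\<in>U. exp (- s * (1 - Re (c * u)))) \<le> 1 + card U * exp (- s * \<eta>)"
proof -
  let ?A = "{u\<in>U. Re (c * u) > 1 - \<eta>}"
  have "card ?A \<le> 1"
    by (rule card_le_Suc0_iff_eq[THEN iffD2, simplified One_nat_def[symmetric]]) (use fin one in auto)
  have "(\<Sum>u\<in>U. exp (- s * (1 - Re (c * u))))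
      \<le> (\<Sum>u\<in>U. of_bool (u \<in> ?A) + exp (- s * \<eta>))"
  proof (rule sum_mono)
    fix u assume u: "u \<in> U"
    show "exp (- s * (1 - Re (c * u))) \<le> of_bool (u \<in> ?A) + exp (- s * \<eta>)"
    proof (cases "u \<in> ?A")
      case True
      have "exp (- s * (1 - Re (c * u))) \<le> 1" using s le[OF u] by simp
      then show ?thesis using True by (simp add: add_increasing2)
    next
      case False
      then have "\<eta> \<le> 1 - Re (c * u)" using u by auto
      then show ?thesis using False s by (simp add: mult_left_mono)
    qed
  qed
  also have "\<dots> = card ?A + card U * exp (- s * \<eta>)"
  proof -
    have "(\<Sum>u\<in>U. of_bool (u \<in> ?A) :: real) = card ?A"
      using fin by (simp add: of_bool_def sum.If_cases Int_def)
    then show ?thesis by (simp add: sum.distrib)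
  qed
  also have "\<dots> \<le> 1 + card U * exp (- s * \<eta>)" using \<open>card ?A \<le> 1\<close> by simp
  finally show ?thesis .
qed

text \<open>The modulus is the largest real part over all rotations, and up to a factor \<open>1 - \<epsilon>\<close> finitely many
  rotations suffice by compactness of the circle.  This replaces the modulus of a sum by a sum of real
  parts, to which a product of exponential weights applies.\<close>

lemma finite_phase_net:
  fixes \<epsilon> :: real
  assumes "\<epsilon> > 0"
  shows "\<exists>W :: complex set. finite W \<and> (\<forall>w\<in>W. cmod w = 1) \<and>
           (\<forall>z. \<exists>w\<in>W. Re (w * z) \<ge> (1 - \<epsilon>) * cmod z)"
proof -
  obtain W where W: "finite W" "W \<subseteq> sphere 0 1" "sphere (0::complex) 1 \<subseteq> (\<Union>w\<in>W. ball w \<epsilon>)"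
    using compact_sphere[of "0::complex" 1] assms unfolding compact_eq_totally_bounded
    by (metis seq_compact_imp_totally_bounded compact_imp_seq_compact compact_sphere)
  have "\<exists>w\<in>W. Re (w * z) \<ge> (1 - \<epsilon>) * cmod z" for z
  proof -
    define v where "v = (if z = 0 then 1 else cnj (sgn z))"
    have v: "cmod v = 1" "v * z = cmod z"
      using complex_norm_square[of z]
      by (simp_all add: v_def norm_sgn sgn_eq power2_eq_square norm_divide field_simps)
    then obtain w where w: "w \<in> W" "cmod (w - v) < \<epsilon>" using W(3) by (auto simp: dist_norm)
    have "cmod z - Re (w * z) = Re ((v - w) * z)" using v(2) by (simp add: left_diff_distrib)
    also have "\<dots> \<le> cmod (v - w) * cmod z" by (metis complex_Re_le_cmod norm_mult)
    also have "\<dots> \<le> \<epsilon> * cmod z" using w(2) by (intro mult_right_mono) (auto simp: norm_minus_commute)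
    finally show ?thesis using w(1) by (intro bexI[of _ w]) (auto simp: algebra_simps)
  qed
  then show ?thesis using W(1,2) by (intro exI[of _ W]) auto
qed

text \<open>The count is an exponential moment bound.  Let the \<open>u\<^sub>k\<close> range over a set \<open>U\<close> of \<open>4 * m\<close>
  phases.  For every \<open>u \<in> U\<^sup>n\<close> some functional \<open>f\<^sub>i\<close> and rotation \<open>w\<close> have total defect
  \<open>\<Sum> (1 - Re (w f\<^sub>i\<^sub>k u\<^sub>k)) \<le> 2 \<delta> n\<close>, that is, a product of weights of at least \<open>2\<^sup>-\<^sup>n\<close>.  On the
  other hand, for a fixed pair \<open>(i, w)\<close> the sum of this product over all \<open>u\<close> factors into \<open>n\<close> sums
  over \<open>U\<close>, each at most \<open>2\<close>.  Hence \<open>(4 m)\<^sup>n \<le> 4\<^sup>n d |W|\<close>, where \<open>W\<close> is the set of rotations.\<close>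

lemma norming_functionals_exponential:
  fixes m :: nat
  assumes m: "m \<ge> 1"
  shows "\<exists>\<delta>>0. \<exists>C>0. \<forall>n d. \<forall>f :: nat \<Rightarrow> nat \<Rightarrow> complex.
    (\<forall>i<d. \<forall>k<n. cmod (f i k) \<le> 1) \<longrightarrow>
    (\<forall>u. (\<forall>k<n. cmod (u k) = 1) \<longrightarrow> (\<exists>i<d. cmod (\<Sum>k<n. u k * f i k) \<ge> (1 - \<delta>) * n)) \<longrightarrow>
    real m ^ n \<le> C * real d"
proof -
  have "infinite (sphere (0::complex) 1)"
  proof -
    have "inj_on cis {0..1}"
    proof (rule inj_onI)
      fix x y :: real assume xy: "x \<in> {0..1}" "y \<in> {0..1}" "cis x = cis y"
      then have "cos x = cos y" by (simp add: complex_eq_iff)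
      moreover have "0 \<le> x" "x \<le> pi" "0 \<le> y" "y \<le> pi" using xy(1,2) pi_gt3 by auto
      ultimately show "x = y" by (metis cos_inj_pi)
    qed
    then have "infinite (cis ` {0..1})" by (simp add: finite_image_iff infinite_Icc)
    then show ?thesis by (rule contrapos_nn) (auto elim!: finite_subset[rotated])
  qed
  then obtain U :: "complex set" where U: "finite U" "card U = 4 * m" "U \<subseteq> sphere 0 1"
    using infinite_arbitrarily_large by metis
  then have U1: "\<And>u. u \<in> U \<Longrightarrow> cmod u = 1" by auto
  obtain \<eta> where \<eta>: "\<eta> > 0" and sep: "\<And>c u v. cmod c \<le> 1 \<Longrightarrow> u \<in> U \<Longrightarrow> v \<in> U \<Longrightarrow>
      Re (c * u) > 1 - \<eta> \<Longrightarrow> Re (c * v) > 1 - \<eta> \<Longrightarrow> u = v"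
    using separated_phases_at_most_one_aligned[OF U(1) U1] by metis
  \<comment> \<open>This \<open>s\<close> makes the \<open>4 * m\<close> misaligned phases contribute at most \<open>1\<close> altogether; \<open>\<delta>\<close> then keeps
    the loss \<open>exp (2 * s * \<delta>)\<close> per coordinate at most \<open>2\<close>.\<close>
  define s where "s = ln (4 * m) / \<eta>"
  have s: "s > 0" using m \<eta> by (simp add: s_def)
  have exps: "4 * m * exp (- s * \<eta>) = 1" using m \<eta> by (simp add: s_def exp_minus)
  define \<delta> where "\<delta> = min 1 (ln 2 / (2 * s))"
  have \<delta>: "\<delta> > 0" "\<delta> \<le> 1" "2 * s * \<delta> \<le> ln 2"
    using s by (auto simp: \<delta>_def min_def field_simps)
  obtain W where W: "finite W" "\<And>w. w \<in> W \<Longrightarrow> cmod w = 1"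
    "\<And>z. \<exists>w\<in>W. Re (w * z) \<ge> (1 - \<delta>) * cmod z"
    using finite_phase_net[OF \<delta>(1)] by metis
  have W0: "card W > 0" using W(1) W(3)[of 0] by (auto simp: card_gt_0_iff)
  have "real m ^ n \<le> card W * real d"
    if f: "\<And>i k. i < d \<Longrightarrow> k < n \<Longrightarrow> cmod (f i k) \<le> 1"
      and norming: "\<And>u. (\<And>k. k < n \<Longrightarrow> cmod (u k) = 1) \<Longrightarrow>
        \<exists>i<d. cmod (\<Sum>k<n. u k * f i k) \<ge> (1 - \<delta>) * n"
    for n d and f :: "nat \<Rightarrow> nat \<Rightarrow> complex"
  proof -
    define P where "P = (\<Pi>\<^sub>E k\<in>{..<n}. U)"
    define I where "I = {..<d} \<times> W"
    define g where "g = (\<lambda>(i, w) k v. exp (- s * (1 - Re (w * f i k * v))))"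
    have one: "1 \<le> 2 ^ n * (\<Sum>p\<in>I. \<Prod>k<n. g p k (u k))" if u: "u \<in> P" for u
    proof -
      have u1: "cmod (u k) = 1" if "k < n" for k using u U1 that by (auto simp: P_def)
      obtain i where i: "i < d" "cmod (\<Sum>k<n. u k * f i k) \<ge> (1 - \<delta>) * n"
        using norming[of u] u1 by blast
      obtain w where w: "w \<in> W"
        "Re (w * (\<Sum>k<n. u k * f i k)) \<ge> (1 - \<delta>) * cmod (\<Sum>k<n. u k * f i k)"
        using W(3) by blast
      have "(1 - 2 * \<delta>) * n \<le> (1 - \<delta>) * ((1 - \<delta>) * n)"
        using \<delta>(1) by (simp add: algebra_simps)
      also have "\<dots> \<le> (1 - \<delta>) * cmod (\<Sum>k<n. u k * f i k)"
        using i(2) \<delta>(2) by (intro mult_left_mono) auto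
      also have "\<dots> \<le> (\<Sum>k<n. Re (w * f i k * u k))"
        using w(2) by (simp add: sum_distrib_left mult_ac del: times_complex.sel)
      finally have "(\<Sum>k<n. 1 - Re (w * f i k * u k)) \<le> 2 * \<delta> * n"
        by (simp add: sum_subtractf algebra_simps del: times_complex.sel)
      then have "s * (\<Sum>k<n. 1 - Re (w * f i k * u k)) \<le> s * (2 * \<delta> * n)"
        using s by (intro mult_left_mono) auto
      also have "\<dots> \<le> ln 2 * n" using mult_right_mono[OF \<delta>(3), of n] by (simp add: mult_ac)
      finally have "exp 0 \<le> exp (ln 2 * n + - s * (\<Sum>k<n. 1 - Re (w * f i k * u k)))"
        by (subst exp_le_cancel_iff) simp
      also have "\<dots> = exp (ln 2 * n) * (\<Prod>k<n. g (i, w) k (u k))"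
        by (simp only: exp_add g_def prod.case sum_distrib_left exp_sum[OF finite_lessThan])
      also have "exp (ln 2 * n) = (2::real) ^ n" by (simp add: exp_of_nat2_mult)
      finally have "1 \<le> 2 ^ n * (\<Prod>k<n. g (i, w) k (u k))" by simp
      also have "(\<Prod>k<n. g (i, w) k (u k)) \<le> (\<Sum>p\<in>I. \<Prod>k<n. g p k (u k))"
        by (rule member_le_sum) (use i w W(1) in \<open>auto simp: I_def g_def intro!: prod_nonneg\<close>)
      finally show ?thesis by simp
    qed
    have two: "(\<Sum>v\<in>U. g p k v) \<le> 2" if p: "p \<in> I" and k: "k < n" for p k
    proof -
      obtain i w where iw: "p = (i, w)" "i < d" "w \<in> W" using p by (auto simp: I_def)
      have c: "cmod (w * f i k) \<le> 1" using f[OF iw(2) k] W(2)[OF iw(3)] by (simp add: norm_mult)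
      have "(\<Sum>v\<in>U. g p k v) \<le> 1 + card U * exp (- s * \<eta>)"
        unfolding iw g_def prod.case
      proof (rule exp_defect_sum_le[OF U(1)])
        show "Re (w * f i k * u) \<le> 1" if "u \<in> U" for u
          using complex_Re_le_cmod[of "w * f i k * u"] c U1[OF that] by (simp add: norm_mult)
      qed (use s sep[OF c] in auto)
      then show ?thesis using exps U(2) by simp
    qed
    have "real (4 * m) ^ n = (\<Sum>u\<in>P. 1)" using U(2) by (simp add: P_def card_PiE)
    also have "\<dots> \<le> (\<Sum>u\<in>P. 2 ^ n * (\<Sum>p\<in>I. \<Prod>k<n. g p k (u k)))"
      by (rule sum_mono) (rule one)
    also have "\<dots> = 2 ^ n * (\<Sum>p\<in>I. \<Sum>u\<in>P. \<Prod>k<n. g p k (u k))"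
      by (subst sum.swap) (simp add: sum_distrib_left)
    also have "(\<Sum>p\<in>I. \<Sum>u\<in>P. \<Prod>k<n. g p k (u k)) = (\<Sum>p\<in>I. \<Prod>k<n. \<Sum>v\<in>U. g p k v)"
      unfolding P_def by (intro sum.cong refl prod_sum_PiE[symmetric]) (use U(1) in auto)
    also have "\<dots> \<le> (\<Sum>p\<in>I. \<Prod>k<n. 2)"
      by (intro sum_mono prod_mono conjI sum_nonneg two) (auto simp: g_def)
    also have "\<dots> = card W * real d * 2 ^ n" by (simp add: I_def card_cartesian_product)
    finally have "4 ^ n * real m ^ n \<le> (2 ^ n * 2 ^ n) * (card W * real d)"
      by (simp add: power_mult_distrib mult_ac)
    moreover have "(2::real) ^ n * 2 ^ n = 4 ^ n" by (simp flip: power_mult_distrib)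
    ultimately show ?thesis by simp
  qed
  then have "\<forall>n d. \<forall>f :: nat \<Rightarrow> nat \<Rightarrow> complex.
    (\<forall>i<d. \<forall>k<n. cmod (f i k) \<le> 1) \<longrightarrow>
    (\<forall>u. (\<forall>k<n. cmod (u k) = 1) \<longrightarrow> (\<exists>i<d. cmod (\<Sum>k<n. u k * f i k) \<ge> (1 - \<delta>) * n)) \<longrightarrow>
    real m ^ n \<le> card W * real d" by blast
  moreover have "real (card W) > 0" using W0 by simp
  ultimately show ?thesis using \<delta>(1) by blast
qed


section \<open>Coordinates in the space of absolutely summable functions\<close>

lift_definition unit_ell1 :: "'i \<Rightarrow> 'i ell1" is "\<lambda>s r. of_bool (r = s)"
  by (simp add: of_bool_def if_distrib[of cmod] cong: if_cong)
    (rule finite_nonzero_values_imp_summable_on, simp)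

lemma ell1_apply_sum: "ell1_apply (\<Sum>s\<in>F. g s) r = (\<Sum>s\<in>F. ell1_apply (g s) r)"
  by (induction F rule: infinite_finite_induct) (simp_all add: zero_ell1.rep_eq plus_ell1.rep_eq)

lemma norm_ell1_le:
  assumes "\<And>F. finite F \<Longrightarrow> (\<Sum>s\<in>F. cmod (ell1_apply x s)) \<le> B"
  shows "norm x \<le> B"
  unfolding norm_ell1.rep_eq by (rule infsum_le_finite_sums[OF ell1_abs_summable]) (use assms in auto)

lemma norm_unit_ell1_le: "norm (unit_ell1 s) \<le> 1"
proof (rule norm_ell1_le)
  fix F :: "'a set" assume "finite F"
  then show "(\<Sum>r\<in>F. cmod (ell1_apply (unit_ell1 s) r)) \<le> 1"
    by (simp add: unit_ell1.rep_eq of_bool_def if_distrib[of cmod] cong: if_cong)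
qed

definition restrict_ell1 :: "'i set \<Rightarrow> 'i ell1 \<Rightarrow> 'i ell1" where
  "restrict_ell1 E x = (\<Sum>s\<in>E. ell1_apply x s *\<^sub>C unit_ell1 s)"

lemma ell1_apply_restrict:
  "finite E \<Longrightarrow> ell1_apply (restrict_ell1 E x) r = (if r \<in> E then ell1_apply x r else 0)"
  by (simp add: restrict_ell1_def ell1_apply_sum scaleC_ell1.rep_eq unit_ell1.rep_eq of_bool_def
      if_distrib[of "(*) _"] cong: if_cong)

lemma restrict_ell1_eq:
  "finite E \<Longrightarrow> (\<And>r. r \<notin> E \<Longrightarrow> ell1_apply x r = 0) \<Longrightarrow> restrict_ell1 E x = x"
  by (rule ell1_eqI) (auto simp: ell1_apply_restrict)

text \<open>The finite set \<open>F\<close> may be enlarged at will, so that it can later be made invariant under a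
  permutation and common to several vectors.\<close>

lemma restrict_ell1_dense:
  assumes e: "e > 0"
  shows "\<exists>F. finite F \<and> (\<forall>E. finite E \<longrightarrow> F \<subseteq> E \<longrightarrow> norm (x - restrict_ell1 E x) \<le> e)"
proof -
  have "((\<lambda>s. cmod (ell1_apply x s)) has_sum norm x) UNIV"
    unfolding norm_ell1.rep_eq by (rule has_sum_infsum[OF ell1_abs_summable])
  then obtain F where F: "finite F" "dist (\<Sum>s\<in>F. cmod (ell1_apply x s)) (norm x) \<le> e"
    using has_sum_finite_approximation[OF _ e] by metis
  have "norm (x - restrict_ell1 E x) \<le> e" if E: "finite E" "F \<subseteq> E" for E
  proof (rule norm_ell1_le)
    fix G :: "'a set" assume G: "finite G"
    have "(\<Sum>s\<in>F. cmod (ell1_apply x s)) + (\<Sum>s\<in>G. cmod (ell1_apply (x - restrict_ell1 E x) s))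
        = (\<Sum>s\<in>F. cmod (ell1_apply x s)) + (\<Sum>s\<in>G - E. cmod (ell1_apply x s))"
      using G E by (simp add: minus_ell1.rep_eq ell1_apply_restrict)
        (auto intro!: sum.mono_neutral_cong_right)
    also have "\<dots> = (\<Sum>s\<in>F \<union> (G - E). cmod (ell1_apply x s))"
      by (rule sum.union_disjoint[symmetric]) (use F G E in auto)
    also have "\<dots> \<le> norm x" by (rule sum_cmod_le_norm_ell1) (use F G in auto)
    finally show "(\<Sum>s\<in>G. cmod (ell1_apply (x - restrict_ell1 E x) s)) \<le> e"
      using F(2) by (simp add: dist_real_def)
  qed
  then show ?thesis using F(1) by blast
qed


section \<open>Weighted permutations and their iterates\<close>

lemma clinear_sum:
  assumes "clinear f"
  shows "f (\<Sum>k\<in>A. g k) = (\<Sum>k\<in>A. f (g k))"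
proof -
  have "f 0 + f 0 = f 0" using assms by (metis clinear_def add_0)
  then have "f 0 = 0" by simp
  then show ?thesis
    using assms by (induction A rule: infinite_finite_induct) (auto simp: clinear_def)
qed

lemma clinear_diff:
  assumes "clinear f"
  shows "f (x - y) = f x - f y"
proof -
  have "f (x - y + y) = f (x - y) + f y" using assms unfolding clinear_def by blast
  then show ?thesis by simp
qed

text \<open>For distinct coordinate vectors \<open>x k\<close> of an \<open>\<ell>\<^sub>1\<close>-space the right-hand side is \<open>\<delta>\<close> times the norm
  of the combination, so closeness on these vectors gives closeness on every bounded set of
  their combinations.\<close>

lemma clinear_combination_error:
  assumes S: "clinear S" and T: "clinear T" and close: "\<And>k. k \<in> A \<Longrightarrow> norm (S (x k) - T (x k)) \<le> \<delta>"
  shows "norm (S (\<Sum>k\<in>A. c k *\<^sub>C x k) - T (\<Sum>k\<in>A. c k *\<^sub>C x k)) \<le> (\<Sum>k\<in>A. cmod (c k)) * \<delta>"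
proof -
  have diff: "S (c k *\<^sub>C x k) - T (c k *\<^sub>C x k) = c k *\<^sub>C (S (x k) - T (x k))" for k
  proof -
    have "c k *\<^sub>C (S (x k) - T (x k)) + c k *\<^sub>C T (x k) = c k *\<^sub>C S (x k)"
      by (simp flip: scaleC_add_right)
    then have "c k *\<^sub>C (S (x k) - T (x k)) = c k *\<^sub>C S (x k) - c k *\<^sub>C T (x k)"
      by (simp add: eq_diff_eq)
    then show ?thesis using S T unfolding clinear_def by simp
  qed
  have "S (\<Sum>k\<in>A. c k *\<^sub>C x k) - T (\<Sum>k\<in>A. c k *\<^sub>C x k) = (\<Sum>k\<in>A. c k *\<^sub>C (S (x k) - T (x k)))"
    by (simp add: clinear_sum[OF S] clinear_sum[OF T] diff flip: sum_subtractf)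
  also have "norm \<dots> \<le> (\<Sum>k\<in>A. cmod (c k) * \<delta>)"
    by (rule sum_norm_le) (simp add: norm_scaleC close mult_left_mono)
  finally show ?thesis by (simp add: sum_distrib_right)
qed

lemma clinear_funpow: "clinear (\<alpha> :: 'a::complex_normed_vector \<Rightarrow> 'a) \<Longrightarrow> clinear (\<alpha> ^^ k)"
  by (induction k) (auto simp: clinear_def)

lemma norm_isometric_funpow: "isometric (\<alpha> :: 'a::complex_normed_vector \<Rightarrow> 'a) \<Longrightarrow> norm ((\<alpha> ^^ k) x) = norm x"
  by (induction k) (auto simp: isometric_def)

lemma cmod_associated_permutation_funpow:
  assumes "associated_permutation \<alpha> \<sigma>"
  shows "cmod (ell1_apply ((\<alpha> ^^ k) x) r) = cmod (ell1_apply x ((\<sigma> ^^ k) r))"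
proof (induction k arbitrary: r)
  case (Suc k)
  have "cmod (ell1_apply (\<alpha> y) r) = cmod (ell1_apply y (\<sigma> r))" for y
    using assms by (auto simp: associated_permutation_def norm_mult)
  from this[of "(\<alpha> ^^ k) x"] show ?case using Suc[of "\<sigma> r"] by (simp add: funpow_swap1[of \<sigma>])
qed simp

lemma finite_range_funpow:
  assumes "p > 0" "(f ^^ p) x = x"
  shows "finite (range (\<lambda>n. (f ^^ n) x))"
proof (rule finite_subset)
  show "range (\<lambda>n. (f ^^ n) x) \<subseteq> (\<lambda>n. (f ^^ n) x) ` {..<p}"
  proof (rule image_subsetI)
    fix n
    have "(f ^^ n) x = (f ^^ (n mod p)) x" by (rule funpow_mod_eq[OF assms(2), symmetric])
    moreover have "n mod p \<in> {..<p}" using assms(1) by simp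
    ultimately show "(f ^^ n) x \<in> (\<lambda>n. (f ^^ n) x) ` {..<p}" by (rule image_eqI)
  qed
qed simp

lemma inv_funpow_funpow:
  assumes "bij \<sigma>"
  shows "(\<sigma> ^^ n) ((inv \<sigma> ^^ n) t) = t" "(inv \<sigma> ^^ n) ((\<sigma> ^^ n) t) = t"
proof -
  have b: "bij (\<sigma> ^^ n)" using assms by (rule bij_fn)
  have "inv (\<sigma> ^^ n) = inv \<sigma> ^^ n" by (rule inv_fn[OF assms])
  then show "(\<sigma> ^^ n) ((inv \<sigma> ^^ n) t) = t" "(inv \<sigma> ^^ n) ((\<sigma> ^^ n) t) = t"
    using b by (metis bij_is_surj surj_f_inv_f, metis bij_is_inj inv_f_f)
qed

lemma infinite_orbit_aperiodic:
  assumes \<sigma>: "bij \<sigma>" and inf: "infinite (perm_orbit \<sigma> t)" and p: "p > 0"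
  shows "(\<sigma> ^^ p) t \<noteq> t"
proof
  assume *: "(\<sigma> ^^ p) t = t"
  then have "(inv \<sigma> ^^ p) t = t" using inv_funpow_funpow(2)[OF \<sigma>, of p t] by simp
  then show False using inf finite_range_funpow[OF p *] finite_range_funpow[OF p, of "inv \<sigma>" t]
    by (simp add: perm_orbit_def)
qed

text \<open>This is the invariance that is used: a coordinate of \<open>\<alpha> x\<close> outside an orbit is, up to a phase, a
  coordinate of \<open>x\<close> outside it.\<close>

lemma perm_orbit_backward:
  assumes \<sigma>: "bij \<sigma>" and r: "\<sigma> r \<in> perm_orbit \<sigma> s"
  shows "r \<in> perm_orbit \<sigma> s"
proof -
  have inv: "inv \<sigma> (\<sigma> r) = r" using \<sigma> by (simp add: bij_is_inj)
  from r consider n where "\<sigma> r = (\<sigma> ^^ n) s" | n where "\<sigma> r = (inv \<sigma> ^^ n) s"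
    unfolding perm_orbit_def by blast
  then show ?thesis
  proof cases
    case 1
    show ?thesis
    proof (cases n)
      case 0
      then have "r = (inv \<sigma> ^^ 1) s" using 1 inv by simp
      then show ?thesis unfolding perm_orbit_def by blast
    next
      case (Suc j)
      then have "\<sigma> r = \<sigma> ((\<sigma> ^^ j) s)" using 1 by simp
      then have "r = (\<sigma> ^^ j) s" by (rule injD[OF bij_is_inj[OF \<sigma>]])
      then show ?thesis unfolding perm_orbit_def by blast
    qed
  next
    case 2
    then have "r = (inv \<sigma> ^^ Suc n) s" using inv by simp
    then show ?thesis unfolding perm_orbit_def by blast
  qed
qed

text \<open>The vector \<open>\<alpha>\<^sup>k e\<^sub>t\<close> is a phase times the unit vector at \<open>\<sigma>\<^sup>-\<^sup>k t\<close>.  Without periodicity these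
  positions are distinct, so the \<open>n\<close> summands have disjoint supports.\<close>

lemma norm_aperiodic_combination_ge:
  fixes \<alpha> :: "'i ell1 \<Rightarrow> 'i ell1"
  assumes perm: "associated_permutation \<alpha> \<sigma>" and aper: "\<And>p. p > 0 \<Longrightarrow> (\<sigma> ^^ p) t \<noteq> t"
    and u: "\<And>k. k < n \<Longrightarrow> cmod (u k) = 1"
  shows "norm (\<Sum>k<n. u k *\<^sub>C (\<alpha> ^^ k) (unit_ell1 t)) \<ge> real n"
proof -
  have \<sigma>: "bij \<sigma>" using perm by (simp add: associated_permutation_def)
  define r where "r j = (inv \<sigma> ^^ j) t" for j
  have r: "(\<sigma> ^^ j) (r j) = t" for j unfolding r_def by (rule inv_funpow_funpow(1)[OF \<sigma>])
  have hit: "(\<sigma> ^^ k) (r j) = t \<longleftrightarrow> k = j" for k j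
  proof
    assume *: "(\<sigma> ^^ k) (r j) = t"
    show "k = j"
    proof (rule ccontr)
      assume "k \<noteq> j"
      then consider p where "p > 0" "k = p + j" | p where "p > 0" "j = p + k"
        by (metis less_imp_add_positive linorder_neqE_nat add.commute)
      then show False using * r[of j] aper by cases (auto simp: funpow_add)
    qed
  qed (simp add: r)
  have inj: "inj r" by (rule injI) (metis hit r)
  have single: "cmod (ell1_apply (\<Sum>k<n. u k *\<^sub>C (\<alpha> ^^ k) (unit_ell1 t)) (r j)) = 1" if "j < n" for j
  proof -
    have "cmod (ell1_apply ((\<alpha> ^^ k) (unit_ell1 t)) (r j)) = of_bool (k = j)" for k
      unfolding cmod_associated_permutation_funpow[OF perm] by (simp add: unit_ell1.rep_eq hit)
    note c = this
    have "ell1_apply (\<Sum>k<n. u k *\<^sub>C (\<alpha> ^^ k) (unit_ell1 t)) (r j)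
        = (\<Sum>k<n. if k = j then u k * ell1_apply ((\<alpha> ^^ k) (unit_ell1 t)) (r j) else 0)"
      unfolding ell1_apply_sum scaleC_ell1.rep_eq
    proof (rule sum.cong[OF refl])
      fix k
      show "u k * ell1_apply ((\<alpha> ^^ k) (unit_ell1 t)) (r j)
        = (if k = j then u k * ell1_apply ((\<alpha> ^^ k) (unit_ell1 t)) (r j) else 0)"
      proof (cases "k = j")
        case False
        then have "ell1_apply ((\<alpha> ^^ k) (unit_ell1 t)) (r j) = 0" using c[of k] by simp
        then show ?thesis using False by simp
      qed simp
    qed
    also have "\<dots> = u j * ell1_apply ((\<alpha> ^^ j) (unit_ell1 t)) (r j)" using that by simp
    finally show ?thesis using u[OF that] c[of j] by (simp add: norm_mult)
  qed
  have "real n = (\<Sum>s\<in>r ` {..<n}. cmod (ell1_apply (\<Sum>k<n. u k *\<^sub>C (\<alpha> ^^ k) (unit_ell1 t)) s))"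
    using inj by (subst sum.reindex) (auto intro: inj_on_subset simp: single)
  also have "\<dots> \<le> norm (\<Sum>k<n. u k *\<^sub>C (\<alpha> ^^ k) (unit_ell1 t))"
    by (rule sum_cmod_le_norm_ell1) simp
  finally show ?thesis .
qed


section \<open>Contractive factorizations and their dimension\<close>

lemma contraction_to_linf_sum:
  assumes "contraction_to_linf d \<phi>"
  shows "\<phi> (\<Sum>k\<in>A. c k *\<^sub>C x k) i = (\<Sum>k\<in>A. c k * \<phi> (x k) i)"
proof -
  have add: "\<phi> (x + y) i = \<phi> x i + \<phi> y i" and mult: "\<phi> (a *\<^sub>C x) i = a * \<phi> x i" for x y a
    using assms by (simp_all add: contraction_to_linf_def)
  have "\<phi> 0 i = 0" using add[of 0 0] by simp
  then show ?thesis by (induction A rule: infinite_finite_induct) (simp_all add: add mult)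
qed

lemma clinear_factorization:
  assumes "contraction_to_linf d \<phi>" "contraction_from_linf d \<psi>"
  shows "clinear (\<lambda>x. \<psi> (\<phi> x))"
  using assms unfolding contraction_to_linf_def contraction_from_linf_def clinear_def by simp

lemma norm_factorization_le:
  assumes "contraction_to_linf d \<phi>" "contraction_from_linf d \<psi>"
  shows "norm (\<psi> (\<phi> x)) \<le> linf_norm d (\<phi> x)" "norm (\<psi> (\<phi> x)) \<le> norm x"
proof -
  show "norm (\<psi> (\<phi> x)) \<le> linf_norm d (\<phi> x)"
    using assms unfolding contraction_to_linf_def contraction_from_linf_def by blast
  also have "\<dots> \<le> norm x" using assms(1) unfolding contraction_to_linf_def by blast
  finally show "norm (\<psi> (\<phi> x)) \<le> norm x" .
qed

lemma rc_attained:
  assumes "CA_embedding \<iota>" "finite \<Omega>" "\<delta> > 0"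
  obtains \<phi> \<psi> where "(\<phi>, \<psi>, rc \<iota> \<Omega> \<delta>) \<in> CA \<iota> \<Omega> \<delta>"
proof -
  let ?D = "{d. \<exists>\<phi> \<psi>. (\<phi>, \<psi>, d) \<in> CA \<iota> \<Omega> \<delta>}"
  have "?D \<noteq> {}" using assms unfolding CA_embedding_def by fast
  then have "Inf ?D \<in> ?D" by (rule Inf_nat_def1)
  then show thesis using that unfolding rc_def by blast
qed

lemma rc_le: "(\<phi>, \<psi>, d) \<in> CA \<iota> \<Omega> \<delta> \<Longrightarrow> rc \<iota> \<Omega> \<delta> \<le> d"
  unfolding rc_def by (rule cInf_lower) auto

lemma rc_pos: "CA_embedding \<iota> \<Longrightarrow> finite \<Omega> \<Longrightarrow> \<delta> > 0 \<Longrightarrow> rc \<iota> \<Omega> \<delta> > 0"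
  by (erule (2) rc_attained) (unfold CA_def, blast)

text \<open>If unimodular combinations of \<open>n\<close> vectors in the unit ball have norm at least \<open>n\<close>, the coordinates
  of the first map of a factorization form a family to which the count of norming functionals applies:
  the second map is a contraction, so the first one cannot shrink such a combination by much.
  The constants depend on \<open>m\<close> only, in particular not on \<open>n\<close>.\<close>

lemma rc_exponential_of_norming:
  assumes m: "m \<ge> 1"
  shows "\<exists>\<delta>>0. \<exists>C>0. \<forall>(x :: nat \<Rightarrow> 'a::complex_banach) (\<iota> :: 'a \<Rightarrow> 'b::complex_banach) n.
    CA_embedding \<iota> \<longrightarrow> (\<forall>k. norm (x k) \<le> 1) \<longrightarrow>
    (\<forall>u. (\<forall>k<n. cmod (u k) = 1) \<longrightarrow> norm (\<Sum>k<n. u k *\<^sub>C x k) \<ge> n) \<longrightarrow>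
    real m ^ n \<le> C * real (rc \<iota> (x ` {..<n}) \<delta>)"
proof -
  obtain \<delta> C where \<delta>: "\<delta> > 0" "C > 0" and count: "\<forall>n d. \<forall>f :: nat \<Rightarrow> nat \<Rightarrow> complex.
    (\<forall>i<d. \<forall>k<n. cmod (f i k) \<le> 1) \<longrightarrow>
    (\<forall>u. (\<forall>k<n. cmod (u k) = 1) \<longrightarrow> (\<exists>i<d. cmod (\<Sum>k<n. u k * f i k) \<ge> (1 - \<delta>) * n)) \<longrightarrow>
    real m ^ n \<le> C * real d"
    using norming_functionals_exponential[OF m] by blast
  have "real m ^ n \<le> C * real (rc \<iota> (x ` {..<n}) \<delta>)"
    if \<iota>: "CA_embedding \<iota>" and x: "\<And>k. norm (x k) \<le> 1"
      and ge: "\<And>u. (\<And>k. k < n \<Longrightarrow> cmod (u k) = 1) \<Longrightarrow> norm (\<Sum>k<n. u k *\<^sub>C x k) \<ge> n"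
    for x :: "nat \<Rightarrow> 'a" and \<iota> :: "'a \<Rightarrow> 'b" and n
  proof -
    define d where "d = rc \<iota> (x ` {..<n}) \<delta>"
    obtain \<phi> \<psi> where "(\<phi>, \<psi>, d) \<in> CA \<iota> (x ` {..<n}) \<delta>"
      using rc_attained[OF \<iota> _ \<delta>(1), of "x ` {..<n}"] unfolding d_def by blast
    then have d: "d > 0" and \<phi>: "contraction_to_linf d \<phi>" and \<psi>: "contraction_from_linf d \<psi>"
      and close: "\<And>k. k < n \<Longrightarrow> norm (\<psi> (\<phi> (x k)) - \<iota> (x k)) < \<delta>"
      by (auto simp: CA_def)
    have lin: "clinear \<iota>" and iso: "isometric \<iota>" using \<iota> by (simp_all add: CA_embedding_def)
    note lin' = clinear_factorization[OF \<phi> \<psi>]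
    have coord: "cmod (\<phi> y i) \<le> linf_norm d (\<phi> y)" if "i < d" for y i
      unfolding linf_norm_def using that by (intro Max_ge) auto
    have "\<exists>i<d. cmod (\<Sum>k<n. u k * \<phi> (x k) i) \<ge> (1 - \<delta>) * n"
      if u: "\<And>k. k < n \<Longrightarrow> cmod (u k) = 1" for u
    proof -
      define y where "y = (\<Sum>k<n. u k *\<^sub>C x k)"
      have "norm (\<psi> (\<phi> y) - \<iota> y) \<le> (\<Sum>k<n. cmod (u k)) * \<delta>"
        unfolding y_def by (rule clinear_combination_error[OF lin' lin]) (use close in force)
      then have "norm (\<psi> (\<phi> y) - \<iota> y) \<le> n * \<delta>" using u by simp
      moreover have "norm (\<iota> y) \<ge> n" using iso ge[OF u] by (simp add: isometric_def y_def)
      moreover have "norm (\<iota> y) \<le> norm (\<psi> (\<phi> y)) + norm (\<psi> (\<phi> y) - \<iota> y)"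
        by (metis norm_minus_commute norm_triangle_sub)
      ultimately have "(1 - \<delta>) * n \<le> norm (\<psi> (\<phi> y))" by (simp add: algebra_simps)
      also have "\<dots> \<le> linf_norm d (\<phi> y)" by (rule norm_factorization_le(1)[OF \<phi> \<psi>])
      finally have le: "(1 - \<delta>) * n \<le> linf_norm d (\<phi> y)" .
      have "linf_norm d (\<phi> y) \<in> (\<lambda>i. cmod (\<phi> y i)) ` {..<d}"
        unfolding linf_norm_def by (rule Max_in) (use d in auto)
      then obtain i where "i < d" "linf_norm d (\<phi> y) = cmod (\<phi> y i)" by auto
      then have "(1 - \<delta>) * n \<le> cmod (\<phi> y i)" "i < d" using le by simp_all
      then show ?thesis
        unfolding y_def contraction_to_linf_sum[OF \<phi>] by blast
    qed
    moreover have "cmod (\<phi> (x k) i) \<le> 1" if "i < d" for i k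
      using coord[OF that, of "x k"] \<phi> x[of k] unfolding contraction_to_linf_def by (meson order_trans)
    ultimately show ?thesis
      using count[rule_format, where d = d and n = n and f = "\<lambda>i k. \<phi> (x k) i"] unfolding d_def by blast
  qed
  then show ?thesis using \<delta>
    by (intro exI[where x = \<delta>], intro conjI, blast, intro exI[where x = C]) auto
qed


section \<open>An infinite orbit\<close>

lemma hc_infinite_orbit:
  fixes \<alpha> :: "'i ell1 \<Rightarrow> 'i ell1" and \<iota> :: "'i ell1 \<Rightarrow> 'b::complex_banach"
  assumes iso: "isometric \<alpha>" and perm: "associated_permutation \<alpha> \<sigma>" and \<iota>: "CA_embedding \<iota>"
    and inf: "infinite (perm_orbit \<sigma> t)"
  shows "hc \<iota> \<alpha> = \<infinity>"
proof -
  have \<sigma>: "bij \<sigma>" using perm by (simp add: associated_permutation_def)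
  define x where "x k = (\<alpha> ^^ k) (unit_ell1 t)" for k
  have x1: "norm (x k) \<le> 1" for k
    by (simp add: x_def norm_isometric_funpow[OF iso] norm_unit_ell1_le)
  have "ereal (ln (real m)) \<le> hc \<iota> \<alpha>" if m: "m \<ge> 1" for m
  proof -
    obtain \<delta> C where \<delta>: "\<delta> > 0" and C: "C > 0" and
      growth: "\<And>n. real m ^ n \<le> C * real (rc \<iota> (x ` {..<n}) \<delta>)"
    proof -
      obtain \<delta> C where *: "\<delta> > 0" "C > 0" "\<forall>(x :: nat \<Rightarrow> 'i ell1) (\<iota> :: 'i ell1 \<Rightarrow> 'b) n.
          CA_embedding \<iota> \<longrightarrow> (\<forall>k. norm (x k) \<le> 1) \<longrightarrow>
          (\<forall>u. (\<forall>k<n. cmod (u k) = 1) \<longrightarrow> norm (\<Sum>k<n. u k *\<^sub>C x k) \<ge> n) \<longrightarrow>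
          real m ^ n \<le> C * real (rc \<iota> (x ` {..<n}) \<delta>)"
        using rc_exponential_of_norming[OF m] by blast
      show thesis
      proof (rule that[OF *(1,2)])
        fix n
        have "norm (\<Sum>k<n. u k *\<^sub>C x k) \<ge> n" if "\<forall>k<n. cmod (u k) = 1" for u
          unfolding x_def using that
          by (intro norm_aperiodic_combination_ge[OF perm] infinite_orbit_aperiodic[OF \<sigma> inf]) auto
        then show "real m ^ n \<le> C * real (rc \<iota> (x ` {..<n}) \<delta>)" using *(3) \<iota> x1 by blast
      qed
    qed
    define a where "a n = 1 / real n * ln (real (rc \<iota> (\<Union>k<n. (\<alpha> ^^ k) ` {unit_ell1 t}) \<delta>))" for n
    have lower: "ln m - ln C / n \<le> a n" if n: "n > 0" for n
    proof -
      have eq: "(\<Union>k<n. (\<alpha> ^^ k) ` {unit_ell1 t}) = x ` {..<n}" by (auto simp: x_def)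
      have pos: "rc \<iota> (x ` {..<n}) \<delta> > 0" by (rule rc_pos[OF \<iota> _ \<delta>]) simp
      have "n * ln m = ln (real m ^ n)" using m by (simp add: ln_realpow)
      also have "\<dots> \<le> ln (C * real (rc \<iota> (x ` {..<n}) \<delta>))"
        using growth[of n] m C pos by (subst ln_le_cancel_iff) auto
      also have "\<dots> = ln C + ln (real (rc \<iota> (x ` {..<n}) \<delta>))"
        using C pos by (simp add: ln_mult)
      finally have "n * ln m - ln C \<le> ln (real (rc \<iota> (x ` {..<n}) \<delta>))" by simp
      then have "(n * ln m - ln C) / n \<le> ln (real (rc \<iota> (x ` {..<n}) \<delta>)) / n"
        by (rule divide_right_mono) simp
      then show ?thesis unfolding a_def eq using n by (simp add: diff_divide_distrib)
    qed
    have "(\<lambda>n. ln m - ln C / real n) \<longlonglongrightarrow> ln m - 0"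
      by (intro tendsto_intros lim_const_over_n)
    then have "(\<lambda>n. ereal (ln m - ln C / real n)) \<longlonglongrightarrow> ereal (ln m)"
      by (simp only: diff_0_right lim_ereal)
    then have "ereal (ln m) = limsup (\<lambda>n. ereal (ln m - ln C / real n))"
      by (intro lim_imp_Limsup[symmetric]) simp_all
    also have "\<dots> \<le> limsup (\<lambda>n. ereal (a n))"
      by (rule Limsup_mono) (auto intro!: eventually_sequentiallyI[of 1] lower)
    also have "\<dots> = hc_set_tol \<iota> \<alpha> {unit_ell1 t} \<delta>" by (simp add: hc_set_tol_def a_def)
    also have "\<dots> \<le> hc_set \<iota> \<alpha> {unit_ell1 t}"
      unfolding hc_set_def by (rule SUP_upper) (use \<delta> in simp)
    also have "\<dots> \<le> hc \<iota> \<alpha>" unfolding hc_def by (rule SUP_upper) simp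
    finally show ?thesis .
  qed
  note ge = this
  have "ereal B \<le> hc \<iota> \<alpha>" for B
  proof -
    obtain m where m: "exp B \<le> real m" using real_arch_simple by blast
    then have "m \<ge> 1" using exp_gt_zero[of B] by (cases m) auto
    moreover have "B \<le> ln m" using m \<open>m \<ge> 1\<close> by (subst ln_ge_iff) auto
    ultimately show ?thesis using ge[of m] by (meson ereal_less_eq(3) order_trans)
  qed
  then show ?thesis by (rule ereal_top)
qed


section \<open>Finite orbits only\<close>

text \<open>The points of \<open>\<Omega>\<close> are cut down to a finite \<open>\<sigma>\<close>-invariant set \<open>E\<close>.  The iterates of \<open>\<alpha>\<close> preserve the
  norm and the support condition, so the cut-down orbits stay in a bounded part of the span of
  the unit vectors in \<open>E\<close>.  The factorization is chosen for these unit vectors alone and does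
  not refer to \<open>n\<close>.\<close>

lemma rc_orbit_bounded:
  fixes \<alpha> :: "'i ell1 \<Rightarrow> 'i ell1" and \<iota> :: "'i ell1 \<Rightarrow> 'b::complex_banach"
  assumes lin: "clinear \<alpha>" and iso: "isometric \<alpha>"
    and perm: "associated_permutation \<alpha> \<sigma>" and \<iota>: "CA_embedding \<iota>"
    and fin: "\<And>s. finite (perm_orbit \<sigma> s)" and \<Omega>: "finite \<Omega>" and \<delta>: "\<delta> > 0"
  shows "\<exists>D. \<forall>n. rc \<iota> (\<Union>k<n. (\<alpha> ^^ k) ` \<Omega>) \<delta> \<le> D"
proof -
  have \<sigma>: "bij \<sigma>" using perm by (simp add: associated_permutation_def)
  have lin\<iota>: "clinear \<iota>" and iso\<iota>: "isometric \<iota>" using \<iota> by (simp_all add: CA_embedding_def)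
  have "\<exists>F. finite F \<and> (\<forall>E. finite E \<longrightarrow> F \<subseteq> E \<longrightarrow> norm (x - restrict_ell1 E x) \<le> \<delta> / 4)" for x :: "'i ell1"
    by (rule restrict_ell1_dense) (use \<delta> in simp)
  then obtain F :: "'i ell1 \<Rightarrow> 'i set" where F: "\<And>x. finite (F x)"
    "\<And>x E. finite E \<Longrightarrow> F x \<subseteq> E \<Longrightarrow> norm (x - restrict_ell1 E x) \<le> \<delta> / 4" by metis
  define E where "E = (\<Union>x\<in>\<Omega>. \<Union>s\<in>F x. perm_orbit \<sigma> s)"
  have E: "finite E" using \<Omega> F(1) fin by (simp add: E_def)
  have FE: "F x \<subseteq> E" if "x \<in> \<Omega>" for x
  proof
    fix s assume s: "s \<in> F x"
    have "s = (\<sigma> ^^ 0) s" by simp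
    then have "s \<in> perm_orbit \<sigma> s" unfolding perm_orbit_def by blast
    then show "s \<in> E" using s that by (auto simp: E_def)
  qed
  have backward: "r \<in> E" if "(\<sigma> ^^ k) r \<in> E" for k r
    using that
  proof (induction k arbitrary: r)
    case (Suc k)
    then have "\<sigma> r \<in> E" by (simp add: funpow_swap1)
    then show ?case unfolding E_def by (blast intro: perm_orbit_backward[OF \<sigma>])
  qed simp
  define M where "M = (\<Sum>x\<in>\<Omega>. norm (restrict_ell1 E x)) + 1"
  have M: "M > 0" "\<And>x. x \<in> \<Omega> \<Longrightarrow> norm (restrict_ell1 E x) \<le> M"
    using member_le_sum[of _ \<Omega> "\<lambda>x. norm (restrict_ell1 E x)"] \<Omega>
    by (auto simp: M_def intro!: add_nonneg_pos sum_nonneg) (meson add_increasing2 order_refl zero_le_one norm_ge_zero)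
  \<comment> \<open>The tolerance \<open>\<delta>\<close> is split into \<open>\<delta> / 4\<close> for the part on \<open>E\<close> (of norm at most \<open>M\<close>) and \<open>\<delta> / 4\<close>
    for each of the two images of the remainder.\<close>
  define \<delta>' where "\<delta>' = \<delta> / (4 * M)"
  have \<delta>': "\<delta>' > 0" using \<delta> M by (simp add: \<delta>'_def)
  define d where "d = rc \<iota> (unit_ell1 ` E) \<delta>'"
  obtain \<phi> \<psi> where "(\<phi>, \<psi>, d) \<in> CA \<iota> (unit_ell1 ` E) \<delta>'"
    using rc_attained[OF \<iota> _ \<delta>', of "unit_ell1 ` E"] E unfolding d_def by blast
  then have d: "d > 0" and \<phi>: "contraction_to_linf d \<phi>" and \<psi>: "contraction_from_linf d \<psi>"
    and close: "\<And>s. s \<in> E \<Longrightarrow> norm (\<psi> (\<phi> (unit_ell1 s)) - \<iota> (unit_ell1 s)) < \<delta>'"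
    by (auto simp: CA_def)
  define T where "T x = \<psi> (\<phi> x)" for x
  have linT: "clinear T" using clinear_factorization[OF \<phi> \<psi>] by (simp add: T_def[abs_def])
  have normT: "norm (T x) \<le> norm x" for x
    unfolding T_def by (rule norm_factorization_le(2)[OF \<phi> \<psi>])
  have supported: "norm (T y - \<iota> y) \<le> norm y * \<delta>'" if y: "\<And>r. r \<notin> E \<Longrightarrow> ell1_apply y r = 0" for y
  proof -
    have "norm (T (restrict_ell1 E y) - \<iota> (restrict_ell1 E y)) \<le> (\<Sum>s\<in>E. cmod (ell1_apply y s)) * \<delta>'"
      unfolding restrict_ell1_def
      by (rule clinear_combination_error[OF linT lin\<iota>]) (use close in \<open>force simp: T_def\<close>)
    also have "\<dots> \<le> norm y * \<delta>'"
      using sum_cmod_le_norm_ell1[OF E] \<delta>' by (intro mult_right_mono) auto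
    also have "restrict_ell1 E y = y" by (rule restrict_ell1_eq[OF E y])
    finally show ?thesis .
  qed
  have approx: "norm (T ((\<alpha> ^^ k) x) - \<iota> ((\<alpha> ^^ k) x)) < \<delta>" if x: "x \<in> \<Omega>" for x k
  proof -
    define y where "y = (\<alpha> ^^ k) (restrict_ell1 E x)"
    define z where "z = (\<alpha> ^^ k) (x - restrict_ell1 E x)"
    have split: "(\<alpha> ^^ k) x = y + z"
      by (simp add: y_def z_def clinear_diff[OF clinear_funpow[OF lin]])
    have z: "norm z \<le> \<delta> / 4" unfolding z_def norm_isometric_funpow[OF iso] by (rule F(2)[OF E FE[OF x]])
    have "ell1_apply y r = 0" if "r \<notin> E" for r
    proof -
      have "(\<sigma> ^^ k) r \<notin> E" using backward that by blast
      then have "cmod (ell1_apply y r) = 0"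
        by (simp add: y_def cmod_associated_permutation_funpow[OF perm] ell1_apply_restrict[OF E])
      then show ?thesis by simp
    qed
    then have "norm (T y - \<iota> y) \<le> norm y * \<delta>'" by (rule supported)
    also have "\<dots> \<le> M * \<delta>'"
      using M(2)[OF x] \<delta>' unfolding y_def norm_isometric_funpow[OF iso] by (intro mult_right_mono) auto
    also have "\<dots> = \<delta> / 4" using M(1) by (simp add: \<delta>'_def)
    finally have y: "norm (T y - \<iota> y) \<le> \<delta> / 4" .
    have "T (y + z) - \<iota> (y + z) = (T y - \<iota> y) + (T z - \<iota> z)"
      using linT lin\<iota> by (simp add: clinear_def)
    then have "norm (T (y + z) - \<iota> (y + z)) \<le> norm (T y - \<iota> y) + (norm (T z) + norm (\<iota> z))"
      by (metis norm_triangle_ineq norm_triangle_ineq4 add_left_mono order_trans)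
    also have "\<dots> \<le> \<delta> / 4 + (\<delta> / 4 + \<delta> / 4)"
      using y z normT[of z] iso\<iota> by (intro add_mono) (auto simp: isometric_def)
    also have "\<dots> < \<delta>" using \<delta> by simp
    finally show ?thesis unfolding split .
  qed
  have "rc \<iota> (\<Union>k<n. (\<alpha> ^^ k) ` \<Omega>) \<delta> \<le> d" for n
    by (rule rc_le[of \<phi> \<psi>]) (use d \<phi> \<psi> approx in \<open>auto simp: CA_def T_def\<close>)
  then show ?thesis by blast
qed

lemma hc_nonneg:
  assumes \<iota>: "CA_embedding \<iota>"
  shows "hc \<iota> \<alpha> \<ge> 0"
proof -
  have "rc \<iota> {} 1 > 0" by (rule rc_pos[OF \<iota>]) auto
  then have "0 \<le> limsup (\<lambda>n. ereal (1 / real n * ln (real (rc \<iota> (\<Union>k<n. (\<alpha> ^^ k) ` {}) 1))))"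
    by (intro le_Limsup) (auto intro!: always_eventually)
  also have "\<dots> = hc_set_tol \<iota> \<alpha> {} 1" by (simp add: hc_set_tol_def)
  also have "\<dots> \<le> hc_set \<iota> \<alpha> {}" unfolding hc_set_def by (rule SUP_upper) simp
  also have "\<dots> \<le> hc \<iota> \<alpha>" unfolding hc_def by (rule SUP_upper) simp
  finally show ?thesis .
qed

lemma hc_finite_orbits:
  fixes \<alpha> :: "'i ell1 \<Rightarrow> 'i ell1" and \<iota> :: "'i ell1 \<Rightarrow> 'b::complex_banach"
  assumes lin: "clinear \<alpha>" and iso: "isometric \<alpha>"
    and perm: "associated_permutation \<alpha> \<sigma>" and \<iota>: "CA_embedding \<iota>"
    and fin: "\<And>s. finite (perm_orbit \<sigma> s)"
  shows "hc \<iota> \<alpha> = 0"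
proof (rule antisym[OF _ hc_nonneg[OF \<iota>]])
  have "hc_set_tol \<iota> \<alpha> \<Omega> \<delta> \<le> 0" if \<Omega>: "finite \<Omega>" and \<delta>: "\<delta> > 0" for \<Omega> \<delta>
  proof -
    obtain D where D: "\<And>n. rc \<iota> (\<Union>k<n. (\<alpha> ^^ k) ` \<Omega>) \<delta> \<le> D"
      using rc_orbit_bounded[OF lin iso perm \<iota> fin \<Omega> \<delta>] by blast
    have "(\<lambda>n. ereal (ln D / real n)) \<longlonglongrightarrow> ereal 0"
      by (intro tendsto_ereal lim_const_over_n)
    then have lim: "limsup (\<lambda>n. ereal (ln D / real n)) = 0"
      by (simp add: lim_imp_Limsup zero_ereal_def)
    have "1 / real n * ln (real (rc \<iota> (\<Union>k<n. (\<alpha> ^^ k) ` \<Omega>) \<delta>)) \<le> ln D / n" for n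
    proof -
      have "rc \<iota> (\<Union>k<n. (\<alpha> ^^ k) ` \<Omega>) \<delta> > 0" by (rule rc_pos[OF \<iota> _ \<delta>]) (use \<Omega> in auto)
      then have "ln (real (rc \<iota> (\<Union>k<n. (\<alpha> ^^ k) ` \<Omega>) \<delta>)) \<le> ln (real D)"
        using D[of n] by (subst ln_le_cancel_iff) auto
      then show ?thesis by (simp add: divide_right_mono)
    qed
    then have "hc_set_tol \<iota> \<alpha> \<Omega> \<delta> \<le> limsup (\<lambda>n. ereal (ln D / real n))"
      unfolding hc_set_tol_def by (intro Limsup_mono always_eventually) simp
    then show ?thesis by (simp add: lim)
  qed
  then show "hc \<iota> \<alpha> \<le> 0" unfolding hc_def hc_set_def by (auto intro!: SUP_least)
qed

theorem proposition11p1: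
  fixes \<alpha> :: "int ell1 \<Rightarrow> int ell1" and \<sigma> :: "int \<Rightarrow> int"
    and \<iota> :: "int ell1 \<Rightarrow> 'b::complex_banach"
  assumes "isometric_automorphism \<alpha>"
    and "associated_permutation \<alpha> \<sigma>"
    and "CA_embedding \<iota>"
  shows "((\<exists>s. infinite (perm_orbit \<sigma> s)) \<longrightarrow> hc \<iota> \<alpha> = \<infinity>) \<and>
         ((\<nexists>s. infinite (perm_orbit \<sigma> s)) \<longrightarrow> hc \<iota> \<alpha> = 0)"
proof -
  have "clinear \<alpha>" "isometric \<alpha>" using assms(1) by (simp_all add: isometric_automorphism_def)
  then show ?thesis
    using hc_infinite_orbit[OF _ assms(2,3)] hc_finite_orbits[OF _ _ assms(2,3)] by blast
qed

end
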